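(* Let $\mathcal P=(\{\succeq_{(t)}\}_{t=0}^T,V_{T+1})$ be a grand preference on the full-history state system $\mathfrak H$, and let $\mathbf U=\{U_t\}_{t=0}^{T+1}$ be a compatible utility system for $\mathcal P$. Suppose that $\mathcal P$ satisfies the six axioms (weak order, continuity, dynamic consistency, terminal compatibility, compensated consumption monotonicity, weak separability) and that $\mathbf U$ satisfies certainty-equivalent richness. Then there exists a full-history recursive structure $\mathcal V$ on $\mathfrak H$ whose generated utility system equals $\mathbf U$. In particular, $(\mathfrak H,\mathcal V)$ represents $\mathcal P$.
   Context: **Primitives.** For an integer $n\ge 0$, $[n]=\{0,1,\dots,n\}$. $T\ge 1$ is an integer horizon. $\mathcal S$ is a finite nonempty set (discrete topology); $\mathcal S_0=\{\bar s_0\}$ is a singleton, $\mathcal S_t=\mathcal S$ for $1\le t\le T$, $\mathcal S_{T+1}=\{\star\}$. $\mathcal C=[0,\bar c]\subset\mathbb R_{\ge 0}$ is a compact interval. Histories: $\mathcal H_0=\{\bar s_0\}$, $\mathcal H_t=\mathcal H_{t-1}\times\mathcal C\times\mathcal S_t$ for $1\le t\le T$, $\mathcal H_{T+1}=\mathcal H_T\times\mathcal C$, with product topologies (compact metrizable). Extension maps $\iota_t:\mathcal H_t\times\mathcal C\times\mathcal S_{t+1}\to\mathcal H_{t+1}$: $\iota_t(h_t,c,s)=(h_t,c,s)$ for $t\in[T-1]$, $\iota_T(h_T,c,\star)=(h_T,c)$. Physical-state projections $\sigma^s_t:\mathcal H_t\to\mathcal S_t$: $\sigma_t^s(h_t)$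 is the last state $s_t$ of $h_t$ for $t\in[T]$, and $\sigma^s_{T+1}\equiv\star$. $\mathfrak H=(\{\mathcal H_t\},\{\sigma^s_t\},\{\iota_t\})$ is the full-history state system. Plans: $\mathcal F_{T+1}=\{\emptyset\}$ and $\mathcal F_t=\mathcal C\times(\mathcal F_{t+1})^{\mathcal S}$ for $t\in[T]$ (product topology); $\mathcal F_T$ is identified with $\mathcal C$. For $t\in[T-1]$ a plan is written $f=(c,f_+)$ with $c\in\mathcal C$ and $f_+:\mathcal S\to\mathcal F_{t+1}$. $\mathcal D_t=\mathcal H_t\times\mathcal F_t$. **Preferences.** A grand preference on $\mathfrak H$ is $\mathcal P=(\{\succeq_{(t)}\}_{t=0}^T,V_{T+1})$ with $\succeq_{(t)}$ a binary relation on $\mathcal D_t$ and $V_{T+1}:\mathcal H_{T+1}\to\mathbb R$ continuous; $\succ_{(t)},\sim_{(t)}$ denote its strict part and indifference. Conditional preference: $f\succeq_{h_t}g$ iff $(h_t,f)\succeq_{(t)}(h_t,g)$. A utility system is $\mathbf U=\{U_t\}_{t=0}^{T+1}$ with $U_t:\mathcal H_t\times\mathcal F_t\to\mathbb R$ ($t\in[T]$) and $U_{T+1}:\mathcal H_{T+1}\to\mathbb R$ continuous. It is compatible with $\mathcal P$ if $U_{T+1}=V_{T+1}$; $U_T(h_T,c)=U_{T+1}(\iota_T(h_T,c,\star))$ for all $h_T,c$; and for all $t\in[T]$, $U_t(h_t,f)\ge U_t(h_t',g)\iff(h_t,f)\succeq_{(t)}(h_t',g)$. **Axioms.** (1) Weak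 order: each $\succeq_{(t)}$, $t\in[T]$, is complete and transitive. (2) Continuity: for each $t\in[T]$ and $(h_t,f)\in\mathcal D_t$, the sets $\{(h_t',g):(h_t',g)\succeq_{(t)}(h_t,f)\}$ and $\{(h_t',g):(h_t,f)\succeq_{(t)}(h_t',g)\}$ are closed in $\mathcal D_t$. (3) Dynamic consistency: for $t\in[T-1]$, $h_t$, $c$, and $f=(c,f_+),g=(c,g_+)\in\mathcal F_t$, if $(\iota_t(h_t,c,s),f_+(s))\succeq_{(t+1)}(\iota_t(h_t,c,s),g_+(s))$ for all $s\in\mathcal S$, then $(h_t,f)\succeq_{(t)}(h_t,g)$. (4) Terminal compatibility: $(h_T,c)\succeq_{(T)}(h_T',c')$ iff $V_{T+1}((h_T,c))\ge V_{T+1}((h_T',c'))$. (5) Compensated consumption monotonicity: for $t\in[T-1]$, $h_t$, $c>c'$ in $\mathcal C$, $f_+,g_+\in(\mathcal F_{t+1})^{\mathcal S}$, if $(\iota_t(h_t,c,s),f_+(s))\sim_{(t+1)}(\iota_t(h_t,c',s),g_+(s))$ for all $s\in\mathcal S$, then $(h_t,(c,f_+))\succ_{(t)}(h_t,(c',g_+))$. (6) Weak separability: for $t\in[T-1]$, $h_t$, $c,c'\in\mathcal C$, $f_+,g_+,f_+',g_+'\in(\mathcal F_{t+1})^{\mathcal S}$, if $(\iota_t(h_t,c,s),f_+(s))\sim_{(t+1)}(\iota_t(h_t,c',s),f'_+(s))$ and $(\iota_t(h_t,c,s),g_+(s))\sim_{(t+1)}(\iota_t(h_t,c',s),g'_+(s))$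 for all $s\in\mathcal S$, then $(h_t,(c,f_+))\succeq_{(t)}(h_t,(c,g_+))\iff(h_t,(c',f'_+))\succeq_{(t)}(h_t,(c',g'_+))$. **Certainty-equivalent richness of $\mathbf U$.** Let $\mathcal L=\mathbb R^{\mathcal S}$ with sup norm and pointwise order; for $v\in\mathbb R$, $\mathbf v\in\mathcal L$ is the constant vector. For $t\in[T-1]$ and $f=(c,f_+)\in\mathcal F_t$ let $[\tilde u_{t+1}(h_t,f)](s)=U_{t+1}(\iota_t(h_t,c,s),f_+(s))$, $s\in\mathcal S$. Let $\Lambda_t^{\mathbf U}(h_t,c)=\{\tilde u_{t+1}(h_t,(c,f_+)):f_+\in(\mathcal F_{t+1})^{\mathcal S}\}$, $\Lambda_t^{\mathbf U}(h_t)=\bigcup_{c\in\mathcal C}\Lambda_t^{\mathbf U}(h_t,c)$, $D_t^M=\{(h_t,\tilde u):\tilde u\in\Lambda_t^{\mathbf U}(h_t)\}$. Richness: for every $t\in[T-1]$ there is a jointly continuous $M_t^0:D_t^M\to\mathbb R$ such that for each $h_t$: (i) for $f=(c,f_+),g=(c,g_+)\in\mathcal F_t$ with the same $c$, $f\succeq_{h_t}g$ iff $M_t^0(h_t,\tilde u_{t+1}(h_t,f))\ge M_t^0(h_t,\tilde u_{t+1}(h_t,g))$, and $M_t^0(h_t,\mathbf v)=v$ whenever $\mathbf v\in\Lambda_t^{\mathbf U}(h_t)$; (ii) $\min_s\tilde u(s)\le M_t^0(h_t,\tilde u)\le\max_s\tilde u(s)$ for $\tilde u\in\Lambda_t^{\mathbf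 U}(h_t)$; (iii) for every $f=(c,f_+)\in\mathcal F_t$, with $v=M_t^0(h_t,\tilde u_{t+1}(h_t,f))$, there is $(c,g_+)\in\mathcal F_t$ with $\tilde u_{t+1}(h_t,(c,g_+))=\mathbf v$; (iv) if $\tilde u\le\tilde v$ in $\Lambda_t^{\mathbf U}(h_t)$ then $M_t^0(h_t,\tilde u)\le M_t^0(h_t,\tilde v)$. **Full-history recursive structure.** A tuple $\mathcal V=(\{W_t\}_{t=0}^{T-1},\{M_t\}_{t=0}^{T-1},V_{T+1}^{\mathcal V})$ where $W_t:\mathcal H_t\times\mathcal C\times\mathbb R\to\mathbb R$ is jointly continuous and nondecreasing in its last argument; $M_t:\mathcal H_t\times\mathcal L\to\mathbb R$ is jointly continuous, monotone ($\tilde u\le\tilde v\Rightarrow M_t(h_t,\tilde u)\le M_t(h_t,\tilde v)$) and satisfies $M_t(h_t,\mathbf v)=v$ for all $v\in\mathbb R$; and $V_{T+1}^{\mathcal V}:\mathcal H_{T+1}\to\mathbb R$ is continuous. $(\mathfrak H,\mathcal V)$ generates $\{U_t^{\mathcal V}\}_{t=0}^{T+1}$ by $U_{T+1}^{\mathcal V}=V_{T+1}^{\mathcal V}$, $U_T^{\mathcal V}(h_T,c)=U_{T+1}^{\mathcal V}(\iota_T(h_T,c,\star))$, and for $t\in[T-1]$, $f=(c,f_+)$: $U_t^{\mathcal V}(h_t,f)=W_t(h_t,c,M_t(h_t,\tilde u_{t+1}^{\mathcal V}(h_t,f)))$ with $[\tilde u_{t+1}^{\mathcal V}(h_t,f)](s)=U_{t+1}^{\mathcal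 V}(\iota_t(h_t,c,s),f_+(s))$. $(\mathfrak H,\mathcal V)$ represents $\mathcal P$ if the generated utility system is compatible with $\mathcal P$. *)

theory Defs
  imports "HOL-Analysis.Analysis"
begin

section \<open>Histories and plans\<close>

text \<open>The finite nonempty set of states is the universe of a type \<open>'s\<close> of class \<open>finite\<close>.
  \<open>Initial\<close> and \<open>Star\<close> are the unique elements of the state spaces at times \<open>0\<close> and \<open>T + 1\<close>.\<close>

datatype 's state = Initial | Phys 's | Star

definition states :: "nat \<Rightarrow> nat \<Rightarrow> 's state set" where
  "states T t = (if t = 0 then {Initial} else if t \<le> T then range Phys else {Star})"

definition Cons_set :: "real \<Rightarrow> real set" where
  "Cons_set cbar = {0..cbar}"

definition Cons_top :: "real \<Rightarrow> real topology" where
  "Cons_top cbar = top_of_set (Cons_set cbar)"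

text \<open>\<open>Start\<close> is the time-0 history, \<open>Extend h c s\<close> is the triple \<open>(h, c, s)\<close>, and \<open>Close h c\<close>
  is the pair \<open>(h, c)\<close> that occurs only at time \<open>T + 1\<close>.\<close>

datatype 's history =
    Start
  | Extend (past: "'s history") (spent: real) (observed: 's)
  | Close (past: "'s history") (spent: real)

text \<open>Pulling a product topology back along the bijective destructor of a constructor makes that
  constructor a homeomorphism.\<close>

primrec open_hist_top :: "real \<Rightarrow> nat \<Rightarrow> 's history topology" where
  "open_hist_top cbar 0 = discrete_topology {Start}"
| "open_hist_top cbar (Suc t) =
     pullback_topology {Extend h c s | h c s. True} (\<lambda>x. (past x, spent x, observed x))
       (prod_topology (open_hist_top cbar t)
         (prod_topology (Cons_top cbar) (discrete_topology UNIV)))"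

definition hist_top :: "nat \<Rightarrow> real \<Rightarrow> nat \<Rightarrow> 's history topology" where
  "hist_top T cbar t =
     (if t \<le> T then open_hist_top cbar t
      else pullback_topology {Close h c | h c. True} (\<lambda>x. (past x, spent x))
             (prod_topology (open_hist_top cbar T) (Cons_top cbar)))"

definition hists :: "nat \<Rightarrow> real \<Rightarrow> nat \<Rightarrow> 's history set" where
  "hists T cbar t = topspace (hist_top T cbar t)"

fun iota :: "'s history \<Rightarrow> real \<Rightarrow> 's state \<Rightarrow> 's history" where
  "iota h c (Phys s) = Extend h c s"
| "iota h c Star = Close h c"
| "iota h c Initial = undefined"

text \<open>Part of the state system, although no axiom below refers to it.\<close>

fun sigma :: "'s history \<Rightarrow> 's state" where
  "sigma Start = Initial"
| "sigma (Extend h c s) = Phys s"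
| "sigma (Close h c) = Star"

datatype 's plan = Done | Plan (cur: real) (cont: "'s \<Rightarrow> 's plan")

text \<open>The numeric argument of \<open>plan_top_rem\<close> is the number \<open>T + 1 - t\<close> of remaining periods.\<close>

primrec plan_top_rem :: "real \<Rightarrow> nat \<Rightarrow> 's plan topology" where
  "plan_top_rem cbar 0 = discrete_topology {Done}"
| "plan_top_rem cbar (Suc k) =
     pullback_topology {Plan c f | c f. True} (\<lambda>p. (cur p, cont p))
       (prod_topology (Cons_top cbar) (product_topology (\<lambda>s. plan_top_rem cbar k) UNIV))"

definition plan_top :: "nat \<Rightarrow> real \<Rightarrow> nat \<Rightarrow> 's plan topology" where
  "plan_top T cbar t = plan_top_rem cbar (Suc T - t)"

definition plans :: "nat \<Rightarrow> real \<Rightarrow> nat \<Rightarrow> 's plan set" where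
  "plans T cbar t = topspace (plan_top T cbar t)"

text \<open>Identification of a consumption level with a plan at time \<open>T\<close>.\<close>

definition last_plan :: "real \<Rightarrow> 's plan" where
  "last_plan c = Plan c (\<lambda>_. Done)"

definition dec_top :: "nat \<Rightarrow> real \<Rightarrow> nat \<Rightarrow> ('s history \<times> 's plan) topology" where
  "dec_top T cbar t = prod_topology (hist_top T cbar t) (plan_top T cbar t)"

definition decs :: "nat \<Rightarrow> real \<Rightarrow> nat \<Rightarrow> ('s history \<times> 's plan) set" where
  "decs T cbar t = hists T cbar t \<times> plans T cbar t"

lemma hists_0: "hists T cbar 0 = {Start}"
  by (simp add: hists_def hist_top_def)

lemma hists_Suc:
  assumes "Suc t \<le> T"
  shows "hists T cbar (Suc t) =
    {Extend h c s | h c s. h \<in> hists T cbar t \<and> c \<in> Cons_set cbar}"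
  using assms by (auto simp: hists_def hist_top_def topspace_pullback_topology Cons_top_def)

lemma hists_final:
  "hists T cbar (Suc T) = {Close h c | h c. h \<in> hists T cbar T \<and> c \<in> Cons_set cbar}"
  by (auto simp: hists_def hist_top_def topspace_pullback_topology Cons_top_def)

lemma plans_final: "plans T cbar (Suc T) = {Done}"
  by (simp add: plans_def plan_top_def)

lemma plans_step:
  assumes "t \<le> T"
  shows "plans T cbar t =
    {Plan c f | c f. c \<in> Cons_set cbar \<and> f \<in> UNIV \<rightarrow> plans T cbar (Suc t)}"
proof -
  have "Suc T - t = Suc (Suc T - Suc t)" using assms by simp
  then show ?thesis
    by (auto simp: plans_def plan_top_def topspace_pullback_topology Cons_top_def PiE_def)
qed

lemma plans_last: "plans T cbar T = last_plan ` Cons_set cbar"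
proof -
  have "f \<in> UNIV \<rightarrow> {Done} \<longleftrightarrow> f = (\<lambda>_. Done)" for f :: "'a \<Rightarrow> 'a plan"
    by auto
  then show ?thesis
    by (auto simp: plans_step plans_final last_plan_def)
qed

lemma iota_in_hists:
  assumes "t \<le> T" "h \<in> hists T cbar t" "c \<in> Cons_set cbar" "x \<in> states T (Suc t)"
  shows "iota h c x \<in> hists T cbar (Suc t)"
  using assms
  by (cases "t = T") (auto simp: states_def hists_Suc hists_final split: if_splits)

lemma sigma_in_states:
  assumes "t \<le> Suc T" "h \<in> hists T cbar t"
  shows "sigma h \<in> states T t"
proof (cases t)
  case 0
  then show ?thesis using assms by (simp add: hists_0 states_def)
next
  case (Suc k)
  then show ?thesis using assms
    by (cases "k = T") (auto simp: states_def hists_Suc hists_final)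
qed


section \<open>Continuation-value vectors\<close>

text \<open>Vectors indexed by states are functions \<open>'s \<Rightarrow> real\<close>; the library order on functions is
  the pointwise one, and the topology is the one of the sup norm.\<close>

definition sup_dist :: "('s::finite \<Rightarrow> real) \<Rightarrow> ('s \<Rightarrow> real) \<Rightarrow> real" where
  "sup_dist u v = (MAX s. \<bar>u s - v s\<bar>)"

definition L_top :: "('s::finite \<Rightarrow> real) topology" where
  "L_top = Metric_space.mtopology UNIV sup_dist"

lemma sup_dist_le_iff: "sup_dist u v \<le> e \<longleftrightarrow> (\<forall>s. \<bar>u s - v s\<bar> \<le> e)"
  by (simp add: sup_dist_def)

lemma sup_dist_ge: "\<bar>u s - v s\<bar> \<le> sup_dist u v"
  using sup_dist_le_iff by blast

lemma Metric_space_sup_dist: "Metric_space UNIV sup_dist"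
proof
  show nn: "0 \<le> sup_dist u v" for u v :: "'a \<Rightarrow> real"
    by (rule order_trans[OF abs_ge_zero sup_dist_ge])
  show "sup_dist u v = sup_dist v u" for u v :: "'a \<Rightarrow> real"
    by (simp add: sup_dist_def abs_minus_commute)
  show "sup_dist u v = 0 \<longleftrightarrow> u = v" for u v :: "'a \<Rightarrow> real"
    using nn[of u v] sup_dist_le_iff[of u v 0] by (auto simp: fun_eq_iff antisym)
  show "sup_dist u w \<le> sup_dist u v + sup_dist v w" for u v w :: "'a \<Rightarrow> real"
    unfolding sup_dist_le_iff
  proof
    fix s
    have "\<bar>u s - w s\<bar> \<le> \<bar>u s - v s\<bar> + \<bar>v s - w s\<bar>" by simp
    also have "\<dots> \<le> sup_dist u v + sup_dist v w"
      by (intro add_mono sup_dist_ge)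
    finally show "\<bar>u s - w s\<bar> \<le> sup_dist u v + sup_dist v w" .
  qed
qed

lemma topspace_L_top: "topspace L_top = UNIV"
  by (simp add: L_top_def Metric_space.topspace_mtopology[OF Metric_space_sup_dist])


section \<open>Preferences and utility systems\<close>

record 's grand_pref =
  pref :: "nat \<Rightarrow> ('s history \<times> 's plan) rel"
  term_util :: "'s history \<Rightarrow> real"

text \<open>\<open>(x, y) \<in> pref P t\<close> reads: \<open>x\<close> is weakly preferred to \<open>y\<close> at time \<open>t\<close>.\<close>

definition strict_pref :: "'s grand_pref \<Rightarrow> nat \<Rightarrow> ('s history \<times> 's plan) rel" where
  "strict_pref P t = {(x, y). (x, y) \<in> pref P t \<and> (y, x) \<notin> pref P t}"

definition indiff :: "'s grand_pref \<Rightarrow> nat \<Rightarrow> ('s history \<times> 's plan) rel" where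
  "indiff P t = {(x, y). (x, y) \<in> pref P t \<and> (y, x) \<in> pref P t}"

definition cond_pref :: "'s grand_pref \<Rightarrow> nat \<Rightarrow> 's history \<Rightarrow> 's plan rel" where
  "cond_pref P t h = {(f, g). ((h, f), (h, g)) \<in> pref P t}"

definition grand_preference :: "nat \<Rightarrow> real \<Rightarrow> 's grand_pref \<Rightarrow> bool" where
  "grand_preference T cbar P \<longleftrightarrow>
     (\<forall>t\<le>T. pref P t \<subseteq> decs T cbar t \<times> decs T cbar t) \<and>
     continuous_map (hist_top T cbar (Suc T)) euclideanreal (term_util P)"

record 's util_sys =
  util :: "nat \<Rightarrow> 's history \<Rightarrow> 's plan \<Rightarrow> real"
  final_util :: "'s history \<Rightarrow> real"

definition utility_system :: "nat \<Rightarrow> real \<Rightarrow> 's util_sys \<Rightarrow> bool" where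
  "utility_system T cbar U \<longleftrightarrow>
     (\<forall>t\<le>T. continuous_map (dec_top T cbar t) euclideanreal (\<lambda>(h, f). util U t h f)) \<and>
     continuous_map (hist_top T cbar (Suc T)) euclideanreal (final_util U)"

definition compatible :: "nat \<Rightarrow> real \<Rightarrow> 's util_sys \<Rightarrow> 's grand_pref \<Rightarrow> bool" where
  "compatible T cbar U P \<longleftrightarrow>
     (\<forall>h\<in>hists T cbar (Suc T). final_util U h = term_util P h) \<and>
     (\<forall>h\<in>hists T cbar T. \<forall>c\<in>Cons_set cbar.
        util U T h (last_plan c) = final_util U (iota h c Star)) \<and>
     (\<forall>t\<le>T. \<forall>h\<in>hists T cbar t. \<forall>h'\<in>hists T cbar t.
        \<forall>f\<in>plans T cbar t. \<forall>g\<in>plans T cbar t.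
          util U t h f \<ge> util U t h' g \<longleftrightarrow> ((h, f), (h', g)) \<in> pref P t)"

definition util_sys_eq :: "nat \<Rightarrow> real \<Rightarrow> 's util_sys \<Rightarrow> 's util_sys \<Rightarrow> bool" where
  "util_sys_eq T cbar U U' \<longleftrightarrow>
     (\<forall>t\<le>T. \<forall>h\<in>hists T cbar t. \<forall>f\<in>plans T cbar t. util U t h f = util U' t h f) \<and>
     (\<forall>h\<in>hists T cbar (Suc T). final_util U h = final_util U' h)"


section \<open>Axioms\<close>

definition weak_order :: "nat \<Rightarrow> real \<Rightarrow> 's grand_pref \<Rightarrow> bool" where
  "weak_order T cbar P \<longleftrightarrow>
     (\<forall>t\<le>T. (\<forall>x\<in>decs T cbar t. \<forall>y\<in>decs T cbar t. (x, y) \<in> pref P t \<or> (y, x) \<in> pref P t) \<and>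
            trans (pref P t))"

definition continuity :: "nat \<Rightarrow> real \<Rightarrow> 's grand_pref \<Rightarrow> bool" where
  "continuity T cbar P \<longleftrightarrow>
     (\<forall>t\<le>T. \<forall>x\<in>decs T cbar t.
        closedin (dec_top T cbar t) {y \<in> decs T cbar t. (y, x) \<in> pref P t} \<and>
        closedin (dec_top T cbar t) {y \<in> decs T cbar t. (x, y) \<in> pref P t})"

definition dynamic_consistency :: "nat \<Rightarrow> real \<Rightarrow> 's grand_pref \<Rightarrow> bool" where
  "dynamic_consistency T cbar P \<longleftrightarrow>
     (\<forall>t<T. \<forall>h\<in>hists T cbar t. \<forall>c\<in>Cons_set cbar.
        \<forall>f \<in> UNIV \<rightarrow> plans T cbar (Suc t). \<forall>g \<in> UNIV \<rightarrow> plans T cbar (Suc t).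
          (\<forall>s. ((iota h c (Phys s), f s), (iota h c (Phys s), g s)) \<in> pref P (Suc t)) \<longrightarrow>
          ((h, Plan c f), (h, Plan c g)) \<in> pref P t)"

definition terminal_compatibility :: "nat \<Rightarrow> real \<Rightarrow> 's grand_pref \<Rightarrow> bool" where
  "terminal_compatibility T cbar P \<longleftrightarrow>
     (\<forall>h\<in>hists T cbar T. \<forall>h'\<in>hists T cbar T. \<forall>c\<in>Cons_set cbar. \<forall>c'\<in>Cons_set cbar.
        ((h, last_plan c), (h', last_plan c')) \<in> pref P T \<longleftrightarrow>
        term_util P (iota h c Star) \<ge> term_util P (iota h' c' Star))"

definition compensated_monotonicity :: "nat \<Rightarrow> real \<Rightarrow> 's grand_pref \<Rightarrow> bool" where
  "compensated_monotonicity T cbar P \<longleftrightarrow>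
     (\<forall>t<T. \<forall>h\<in>hists T cbar t. \<forall>c\<in>Cons_set cbar. \<forall>c'\<in>Cons_set cbar.
        \<forall>f \<in> UNIV \<rightarrow> plans T cbar (Suc t). \<forall>g \<in> UNIV \<rightarrow> plans T cbar (Suc t).
          c > c' \<longrightarrow>
          (\<forall>s. ((iota h c (Phys s), f s), (iota h c' (Phys s), g s)) \<in> indiff P (Suc t)) \<longrightarrow>
          ((h, Plan c f), (h, Plan c' g)) \<in> strict_pref P t)"

definition weak_separability :: "nat \<Rightarrow> real \<Rightarrow> 's grand_pref \<Rightarrow> bool" where
  "weak_separability T cbar P \<longleftrightarrow>
     (\<forall>t<T. \<forall>h\<in>hists T cbar t. \<forall>c\<in>Cons_set cbar. \<forall>c'\<in>Cons_set cbar.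
        \<forall>f \<in> UNIV \<rightarrow> plans T cbar (Suc t). \<forall>g \<in> UNIV \<rightarrow> plans T cbar (Suc t).
        \<forall>f' \<in> UNIV \<rightarrow> plans T cbar (Suc t). \<forall>g' \<in> UNIV \<rightarrow> plans T cbar (Suc t).
          (\<forall>s. ((iota h c (Phys s), f s), (iota h c' (Phys s), f' s)) \<in> indiff P (Suc t)) \<longrightarrow>
          (\<forall>s. ((iota h c (Phys s), g s), (iota h c' (Phys s), g' s)) \<in> indiff P (Suc t)) \<longrightarrow>
          (((h, Plan c f), (h, Plan c g)) \<in> pref P t \<longleftrightarrow>
           ((h, Plan c' f'), (h, Plan c' g')) \<in> pref P t))"


section \<open>Certainty-equivalent richness\<close>

definition cont_util :: "'s util_sys \<Rightarrow> nat \<Rightarrow> 's history \<Rightarrow> 's plan \<Rightarrow> 's \<Rightarrow> real" where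
  "cont_util U t h f = (\<lambda>s. util U (Suc t) (iota h (cur f) (Phys s)) (cont f s))"

definition Lambda_at ::
    "nat \<Rightarrow> real \<Rightarrow> 's util_sys \<Rightarrow> nat \<Rightarrow> 's history \<Rightarrow> real \<Rightarrow> ('s \<Rightarrow> real) set" where
  "Lambda_at T cbar U t h c =
     {cont_util U t h (Plan c f) | f. f \<in> UNIV \<rightarrow> plans T cbar (Suc t)}"

definition Lambda ::
    "nat \<Rightarrow> real \<Rightarrow> 's util_sys \<Rightarrow> nat \<Rightarrow> 's history \<Rightarrow> ('s \<Rightarrow> real) set" where
  "Lambda T cbar U t h = (\<Union>c\<in>Cons_set cbar. Lambda_at T cbar U t h c)"

definition DM :: "nat \<Rightarrow> real \<Rightarrow> 's util_sys \<Rightarrow> nat \<Rightarrow> ('s history \<times> ('s \<Rightarrow> real)) set" where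
  "DM T cbar U t = {(h, u). h \<in> hists T cbar t \<and> u \<in> Lambda T cbar U t h}"

definition ce_richness :: "nat \<Rightarrow> real \<Rightarrow> 's::finite util_sys \<Rightarrow> 's grand_pref \<Rightarrow> bool" where
  "ce_richness T cbar U P \<longleftrightarrow>
     (\<forall>t<T. \<exists>M0 :: 's history \<Rightarrow> ('s \<Rightarrow> real) \<Rightarrow> real.
        continuous_map
          (subtopology (prod_topology (hist_top T cbar t) L_top) (DM T cbar U t))
          euclideanreal (\<lambda>(h, u). M0 h u) \<and>
        (\<forall>h\<in>hists T cbar t.
          (\<forall>c\<in>Cons_set cbar.
             \<forall>f \<in> UNIV \<rightarrow> plans T cbar (Suc t). \<forall>g \<in> UNIV \<rightarrow> plans T cbar (Suc t).
               (Plan c f, Plan c g) \<in> cond_pref P t h \<longleftrightarrow>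
               M0 h (cont_util U t h (Plan c f)) \<ge> M0 h (cont_util U t h (Plan c g))) \<and>
          (\<forall>v. (\<lambda>_. v) \<in> Lambda T cbar U t h \<longrightarrow> M0 h (\<lambda>_. v) = v) \<and>
          (\<forall>u\<in>Lambda T cbar U t h. (MIN s. u s) \<le> M0 h u \<and> M0 h u \<le> (MAX s. u s)) \<and>
          (\<forall>c\<in>Cons_set cbar. \<forall>f \<in> UNIV \<rightarrow> plans T cbar (Suc t).
             \<exists>g \<in> UNIV \<rightarrow> plans T cbar (Suc t).
               cont_util U t h (Plan c g) = (\<lambda>_. M0 h (cont_util U t h (Plan c f)))) \<and>
          (\<forall>u\<in>Lambda T cbar U t h. \<forall>v\<in>Lambda T cbar U t h. u \<le> v \<longrightarrow> M0 h u \<le> M0 h v)))"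


section \<open>Recursive structures\<close>

record 's rec_struct =
  agg :: "nat \<Rightarrow> 's history \<Rightarrow> real \<Rightarrow> real \<Rightarrow> real"
  ceq :: "nat \<Rightarrow> 's history \<Rightarrow> ('s \<Rightarrow> real) \<Rightarrow> real"
  struct_term :: "'s history \<Rightarrow> real"

definition recursive_structure :: "nat \<Rightarrow> real \<Rightarrow> 's::finite rec_struct \<Rightarrow> bool" where
  "recursive_structure T cbar V \<longleftrightarrow>
     (\<forall>t<T.
        continuous_map
          (prod_topology (hist_top T cbar t) (prod_topology (Cons_top cbar) euclideanreal))
          euclideanreal (\<lambda>(h, c, v). agg V t h c v) \<and>
        (\<forall>h\<in>hists T cbar t. \<forall>c\<in>Cons_set cbar. mono (agg V t h c)) \<and>
        continuous_map (prod_topology (hist_top T cbar t) L_top)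
          euclideanreal (\<lambda>(h, u). ceq V t h u) \<and>
        (\<forall>h\<in>hists T cbar t. mono (ceq V t h) \<and> (\<forall>v. ceq V t h (\<lambda>_. v) = v))) \<and>
     continuous_map (hist_top T cbar (Suc T)) euclideanreal (struct_term V)"

text \<open>Backward induction in time is recursion on the plan; the argument \<open>t\<close> is the date at which
  the plan starts.\<close>

primrec gen_util ::
    "nat \<Rightarrow> 's rec_struct \<Rightarrow> 's plan \<Rightarrow> nat \<Rightarrow> 's history \<Rightarrow> real" where
  "gen_util T V Done t h = struct_term V h"
| "gen_util T V (Plan c f) t h =
     (if t < T then agg V t h c (ceq V t h (\<lambda>s. gen_util T V (f s) (Suc t) (iota h c (Phys s))))
      else struct_term V (iota h c Star))"

definition generated :: "nat \<Rightarrow> 's rec_struct \<Rightarrow> 's util_sys" where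
  "generated T V = \<lparr>util = (\<lambda>t h f. gen_util T V f t h), final_util = struct_term V\<rparr>"

lemma final_util_generated: "final_util (generated T V) h = struct_term V h"
  by (simp add: generated_def)

lemma util_generated_last:
  "util (generated T V) T h (last_plan c) = final_util (generated T V) (iota h c Star)"
  by (simp add: generated_def last_plan_def)

lemma util_generated_step:
  assumes "t < T"
  shows "util (generated T V) t h (Plan c f) =
    agg V t h c (ceq V t h (cont_util (generated T V) t h (Plan c f)))"
  using assms by (simp add: generated_def cont_util_def)

definition represents :: "nat \<Rightarrow> real \<Rightarrow> 's rec_struct \<Rightarrow> 's grand_pref \<Rightarrow> bool" where
  "represents T cbar V P \<longleftrightarrow>
     utility_system T cbar (generated T V) \<and> compatible T cbar (generated T V) P"

end

theory Submission
  imports Defs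
begin

text \<open>At each date the certainty equivalent \<open>M\<^sub>t\<close> extends the given \<open>M\<^sub>t\<^sup>0\<close>, and the aggregator
  \<open>W\<^sub>t\<close> extends the assignment \<open>(h, c, M\<^sub>t\<^sup>0(h, u(h, f))) \<mapsto> U\<^sub>t(h, f)\<close>, which is well defined and
  nondecreasing because \<open>M\<^sub>t\<^sup>0\<close> ranks plans with equal current consumption as \<open>U\<^sub>t\<close> does. Both are
  continuous monotone functions on compact sets, so both extensions come from one theorem of Nachbin
  type, proved by a McShane formula for an asymmetric distance whose zero set is the order.\<close>

section \<open>Monotone extension from compact sets\<close>

text \<open>Countably many bounds, each linear in \<open>r\<close> up to a small error, are merged
  into one modulus. The infimum of the affine functions with intercepts 1/(n+1) and slopes
  \<open>B n\<close> is the largest function below all of them, which is the last property.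
  Continuity at 0 comes from the intercepts tending to 0.\<close>

lemma concave_modulus:
  fixes B :: "nat \<Rightarrow> real"
  assumes B: "\<And>n. 0 \<le> B n"
  obtains \<omega> :: "real \<Rightarrow> real"
  where "\<omega> 0 = 0"
    and "\<And>r s s'. 0 \<le> r \<Longrightarrow> 0 \<le> s \<Longrightarrow> 0 \<le> s' \<Longrightarrow> r \<le> s + s' \<Longrightarrow> \<omega> r \<le> \<omega> s + \<omega> s'"
    and "\<And>r. 0 \<le> r \<Longrightarrow> 0 \<le> \<omega> r"
    and "\<And>e. 0 < e \<Longrightarrow> \<exists>\<delta>>0. \<forall>r. 0 \<le> r \<longrightarrow> r < \<delta> \<longrightarrow> \<omega> r < e"
    and "\<And>x r. 0 \<le> r \<Longrightarrow> (\<And>n. x \<le> inverse (real (Suc n)) + B n * r) \<Longrightarrow> x \<le> \<omega> r"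
proof -
  define a :: "nat \<Rightarrow> real" where "a n = inverse (real (Suc n))" for n
  define \<omega> where "\<omega> r = (INF n. a n + B n * r)" for r
  have a: "0 < a n" for n by (simp add: a_def)
  have le: "\<omega> r \<le> a n + B n * r" if "0 \<le> r" for r n
    unfolding \<omega>_def
  proof (rule cINF_lower)
    show "bdd_below (range (\<lambda>n. a n + B n * r))"
      using that B less_imp_le[OF a] by (intro bdd_belowI[where m=0]) auto
  qed simp
  have ge: "x \<le> \<omega> r" if "\<And>n. x \<le> a n + B n * r" for x r
    unfolding \<omega>_def using that by (intro cINF_greatest) auto
  have nonneg: "0 \<le> \<omega> r" if "0 \<le> r" for r
    using that B less_imp_le[OF a] by (intro ge) auto
  \<comment> \<open>A line with intercept below \<open>e / 2\<close> is fixed first. Adding 1 to its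
    slope avoids division by zero in the choice of \<delta>.\<close>
  have small: "\<exists>\<delta>>0. \<forall>r. 0 \<le> r \<longrightarrow> r < \<delta> \<longrightarrow> \<omega> r < e" if e: "0 < e" for e
  proof -
    obtain n where n: "a n < e / 2"
      using reals_Archimedean[of "e/2"] e by (auto simp: a_def)
    have "\<omega> r < e" if r: "0 \<le> r" "r < e / 2 / (B n + 1)" for r
    proof -
      have "B n * r \<le> (B n + 1) * r" using r by (simp add: algebra_simps)
      also have "\<dots> < e / 2" using r B[of n] by (simp add: field_simps add_pos_nonneg)
      finally show ?thesis using le[OF r(1), of n] n by linarith
    qed
    moreover have "0 < e / 2 / (B n + 1)" using e B[of n] by (simp add: add_nonneg_pos)
    ultimately show ?thesis by blast
  qed
  have sub: "\<omega> r \<le> \<omega> s + \<omega> s'" if r: "0 \<le> r" "0 \<le> s" "0 \<le> s'" "r \<le> s + s'" for r s s'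
  proof -
    \<comment> \<open>Of the two lines, the one with the smaller slope is used at \<open>r\<close>:
      its slope serves both summands, and the intercept of the other line is positive. Taking the
      infimum over \<open>m\<close> and then over \<open>n\<close> gives the subadditivity.\<close>
    have key: "\<omega> r \<le> (a n + B n * s) + (a m + B m * s')" for n m
    proof (cases "B n \<le> B m")
      case True
      have "B n * r \<le> B n * (s + s')" using r B by (intro mult_left_mono) auto
      also have "\<dots> \<le> B n * s + B m * s'"
        using True r by (simp add: distrib_left mult_right_mono)
      finally show ?thesis using le[OF r(1), of n] a[of m] by linarith
    next
      case False
      have "B m * r \<le> B m * (s + s')" using r B by (intro mult_left_mono) auto
      also have "\<dots> \<le> B n * s + B m * s'"
        using False r by (simp add: distrib_left mult_right_mono)
      finally show ?thesis using le[OF r(1), of m] a[of n] by linarith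
    qed
    have "\<omega> r - \<omega> s' \<le> \<omega> s"
    proof (rule ge)
      fix n
      have "\<omega> r - (a n + B n * s) \<le> \<omega> s'"
        by (rule ge) (use key[of n] in \<open>simp add: algebra_simps\<close>)
      then show "\<omega> r - \<omega> s' \<le> a n + B n * s" by simp
    qed
    then show ?thesis by simp
  qed
  have "\<omega> 0 = 0"
  proof (rule ccontr)
    assume "\<omega> 0 \<noteq> 0"
    then have "0 < \<omega> 0" using nonneg[of 0] by simp
    then show False using small[of "\<omega> 0"] by auto
  qed
  then show thesis using that[of \<omega>] sub nonneg small ge by (auto simp: a_def)
qed

text \<open>The order is \<open>z' \<le> z \<longleftrightarrow> q z z' = 0\<close>. The extension is the supremum of
  \<open>g k - \<omega> (q z (p k))\<close> over \<open>k\<close>, where compactness supplies a modulus \<open>\<omega>\<close> of \<open>g\<close> with respect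
  to \<open>q\<close>.\<close>

lemma monotone_extension:
  fixes K :: "'k topology" and Z :: "'z topology" and q :: "'z \<Rightarrow> 'z \<Rightarrow> real"
  assumes K: "compact_space K" and p: "continuous_map K Z p"
    and g: "continuous_map K euclideanreal g"
    and q: "continuous_map (prod_topology Z Z) euclideanreal (\<lambda>(x, y). q x y)"
    and q_nonneg: "\<And>x y. x \<in> topspace Z \<Longrightarrow> y \<in> topspace Z \<Longrightarrow> 0 \<le> q x y"
    and q_refl: "\<And>x. x \<in> topspace Z \<Longrightarrow> q x x = 0"
    and q_triangle: "\<And>x y z. x \<in> topspace Z \<Longrightarrow> y \<in> topspace Z \<Longrightarrow> z \<in> topspace Z \<Longrightarrow>
      q x z \<le> q x y + q y z"
    and mono: "\<And>k k'. k \<in> topspace K \<Longrightarrow> k' \<in> topspace K \<Longrightarrow> q (p k) (p k') = 0 \<Longrightarrow> g k' \<le> g k"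
  obtains F where "continuous_map Z euclideanreal F"
    and "\<And>k. k \<in> topspace K \<Longrightarrow> F (p k) = g k"
    and "\<And>z z'. z \<in> topspace Z \<Longrightarrow> z' \<in> topspace Z \<Longrightarrow> q z z' = 0 \<Longrightarrow> F z' \<le> F z"
proof (cases "topspace K = {}")
  case True
  then show thesis using that[of "\<lambda>_. 0"] by simp
next
  case ne: False
  have pZ: "p k \<in> topspace Z" if "k \<in> topspace K" for k
    using p that by (auto simp: continuous_map_def)
  obtain G where G: "\<And>k. k \<in> topspace K \<Longrightarrow> \<bar>g k\<bar> \<le> G"
  proof -
    have "bounded (g ` topspace K)"
      using image_compactin[OF K[unfolded compact_space_def] g]
      by (simp add: compact_imp_bounded)
    then show ?thesis using that by (auto simp: bounded_iff)
  qed
  have G0: "0 \<le> G" using ne G by (meson abs_ge_zero all_not_in_conv order_trans)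
  \<comment> \<open>A Lipschitz bound up to the error \<open>e\<close>. On the compact set of pairs
    where \<open>g\<close> rises by at least \<open>e\<close>, \<open>q\<close> cannot vanish, since
    \<open>mono\<close> would forbid the rise. Hence it has a positive minimum \<open>m\<close>
    there; off this set the error alone suffices.\<close>
  have bound: "\<exists>B\<ge>0. \<forall>k\<in>topspace K. \<forall>k'\<in>topspace K. g k' - g k \<le> e + B * q (p k) (p k')"
    if e: "0 < e" for e
  proof -
    let ?KK = "prod_topology K K"
    let ?r = "\<lambda>x. q (p (fst x)) (p (snd x))"
    let ?C = "{x \<in> topspace ?KK. g (snd x) - g (fst x) \<in> {e..}}"
    have g1: "continuous_map ?KK euclideanreal (\<lambda>x. g (fst x))"
      and g2: "continuous_map ?KK euclideanreal (\<lambda>x. g (snd x))"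
      using continuous_map_compose[OF continuous_map_fst g]
        continuous_map_compose[OF continuous_map_snd g] by (auto simp: o_def)
    have p1: "continuous_map ?KK Z (\<lambda>x. p (fst x))" and p2: "continuous_map ?KK Z (\<lambda>x. p (snd x))"
      using continuous_map_compose[OF continuous_map_fst p]
        continuous_map_compose[OF continuous_map_snd p] by (auto simp: o_def)
    have "closedin ?KK ?C"
      by (rule closedin_continuous_map_preimage[where Y=euclideanreal])
         (auto intro!: continuous_map_diff g1 g2)
    moreover have KK: "compactin ?KK (topspace ?KK)"
      using K by (metis compact_space_def compact_space_prod_topology)
    ultimately have C: "compactin ?KK ?C"
      by (intro closed_compactin[OF KK]) auto
    have r: "continuous_map ?KK euclideanreal ?r"
      using continuous_map_compose[OF continuous_map_pairedI[OF p1 p2] q] by (simp add: o_def)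
    have cr: "compact (?r ` ?C)" using image_compactin[OF C r] by simp
    show ?thesis
    proof (cases "?C = {}")
      case True
      then have "g k' - g k \<le> e" if "k \<in> topspace K" "k' \<in> topspace K" for k k'
        using that by (force simp: not_le)
      then show ?thesis by (intro exI[of _ 0]) auto
    next
      case False
      then obtain m where m: "m \<in> ?r ` ?C" and min: "\<And>y. y \<in> ?r ` ?C \<Longrightarrow> m \<le> y"
        using compact_attains_inf[OF cr] by blast
      obtain x where x: "x \<in> ?C" "m = ?r x" using m by blast
      have "0 \<le> m" using x q_nonneg pZ by auto
      moreover have "m \<noteq> 0"
        using x mono[of "fst x" "snd x"] e by auto
      ultimately have m0: "0 < m" by simp
      \<comment> \<open>The oscillation of \<open>g\<close> is at most \<open>2 * G\<close>, and
        \<open>q\<close> divided by \<open>m\<close> is at least 1 on \<open>?C\<close>, so the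
        slope \<open>2 * G / m\<close> suffices.\<close>
      have "g k' - g k \<le> e + 2 * G / m * q (p k) (p k')"
        if k: "k \<in> topspace K" "k' \<in> topspace K" for k k'
      proof (cases "g k' - g k < e")
        case True
        moreover have "0 \<le> 2 * G / m * q (p k) (p k')"
          using G0 m0 q_nonneg pZ k by simp
        ultimately show ?thesis by linarith
      next
        case False
        then have "(k, k') \<in> ?C" using k by auto
        then have "m \<le> q (p k) (p k')" using min by (metis (no_types, lifting) fst_conv imageI snd_conv)
        then have "2 * G / m * m \<le> 2 * G / m * q (p k) (p k')"
          using G0 m0 by (intro mult_left_mono) auto
        moreover have "g k' - g k \<le> 2 * G" using G[OF k(1)] G[OF k(2)] by linarith
        ultimately show ?thesis using m0 e by simp
      qed
      then show ?thesis using G0 m0 by (intro exI[of _ "2 * G / m"]) auto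
    qed
  qed
  then have "\<forall>n. \<exists>B\<ge>0. \<forall>k\<in>topspace K. \<forall>k'\<in>topspace K.
      g k' - g k \<le> inverse (real (Suc n)) + B * q (p k) (p k')"
    by simp
  then obtain B where B: "\<And>n. 0 \<le> B n"
    and gB: "\<And>n k k'. k \<in> topspace K \<Longrightarrow> k' \<in> topspace K \<Longrightarrow>
      g k' - g k \<le> inverse (real (Suc n)) + B n * q (p k) (p k')"
    by metis
  obtain \<omega> where \<omega>0: "\<omega> 0 = 0"
    and \<omega>_sub: "\<And>r s s'. 0 \<le> r \<Longrightarrow> 0 \<le> s \<Longrightarrow> 0 \<le> s' \<Longrightarrow> r \<le> s + s' \<Longrightarrow> \<omega> r \<le> \<omega> s + \<omega> s'"
    and \<omega>_nonneg: "\<And>r. 0 \<le> r \<Longrightarrow> 0 \<le> \<omega> r"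
    and \<omega>_small: "\<And>e. 0 < e \<Longrightarrow> \<exists>\<delta>>0. \<forall>r. 0 \<le> r \<longrightarrow> r < \<delta> \<longrightarrow> \<omega> r < e"
    and \<omega>_ge: "\<And>x r. 0 \<le> r \<Longrightarrow> (\<And>n. x \<le> inverse (real (Suc n)) + B n * r) \<Longrightarrow> x \<le> \<omega> r"
    using concave_modulus[where B=B, OF B] by blast
  define F where "F z = (SUP k\<in>topspace K. g k - \<omega> (q z (p k)))" for z
  have upper: "g k - \<omega> (q z (p k)) \<le> F z" if "z \<in> topspace Z" "k \<in> topspace K" for z k
    unfolding F_def
  proof (rule cSUP_upper[OF that(2)])
    show "bdd_above ((\<lambda>k. g k - \<omega> (q z (p k))) ` topspace K)"
    proof (rule bdd_aboveI2[where M=G])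
      fix k assume k: "k \<in> topspace K"
      show "g k - \<omega> (q z (p k)) \<le> G"
        using G[OF k] \<omega>_nonneg[OF q_nonneg[OF that(1) pZ[OF k]]] by linarith
    qed
  qed
  \<comment> \<open>This one-sided estimate carries the rest of the proof: used in both directions
    it gives continuity, and at \<open>q z z' = 0\<close> it gives monotonicity.\<close>
  have step: "F z' \<le> F z + \<omega> (q z z')" if z: "z \<in> topspace Z" "z' \<in> topspace Z" for z z'
    unfolding F_def[of z']
  proof (rule cSUP_least[OF ne])
    fix k assume k: "k \<in> topspace K"
    have "\<omega> (q z (p k)) \<le> \<omega> (q z z') + \<omega> (q z' (p k))"
      using z pZ[OF k] by (intro \<omega>_sub q_nonneg q_triangle)
    then show "g k - \<omega> (q z' (p k)) \<le> F z + \<omega> (q z z')"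
      using upper[OF z(1) k] by linarith
  qed
  have "continuous_map Z Met_TC.mtopology F"
    unfolding Met_TC.continuous_map_to_metric
  proof (intro ballI allI impI)
    fix z and e :: real assume z: "z \<in> topspace Z" and e: "0 < e"
    obtain \<delta> where \<delta>: "0 < \<delta>" "\<And>r. 0 \<le> r \<Longrightarrow> r < \<delta> \<Longrightarrow> \<omega> r < e"
      using \<omega>_small[OF e] by blast
    have c1: "continuous_map Z euclideanreal (\<lambda>y. q z y)"
      and c2: "continuous_map Z euclideanreal (\<lambda>y. q y z)"
      using continuous_map_compose[OF continuous_map_pairedI[of Z Z "\<lambda>_. z" Z "\<lambda>y. y"] q]
        continuous_map_compose[OF continuous_map_pairedI[of Z Z "\<lambda>y. y" Z "\<lambda>_. z"] q] z
      by (auto simp: o_def)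
    \<comment> \<open>Since \<open>q\<close> need not be symmetric, a neighbourhood must make both
      \<open>q z y\<close> and \<open>q y z\<close> small.\<close>
    let ?U = "{y \<in> topspace Z. q z y \<in> {..<\<delta>}} \<inter> {y \<in> topspace Z. q y z \<in> {..<\<delta>}}"
    have "openin Z ?U"
      by (intro openin_Int openin_continuous_map_preimage[OF c1]
          openin_continuous_map_preimage[OF c2]) auto
    moreover have "z \<in> ?U" using z \<delta> q_refl by auto
    moreover have "\<forall>y\<in>?U. F y \<in> Met_TC.mball (F z) e"
    proof
      fix y assume y: "y \<in> ?U"
      then have "\<omega> (q z y) < e" "\<omega> (q y z) < e" using \<delta> q_nonneg z by auto
      then show "F y \<in> Met_TC.mball (F z) e"
        using step[OF z, of y] step[OF _ z, of y] y by (auto simp: dist_real_def)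
    qed
    ultimately show "\<exists>U. openin Z U \<and> z \<in> U \<and> (\<forall>y\<in>U. F y \<in> Met_TC.mball (F z) e)"
      by blast
  qed
  then have contF: "continuous_map Z euclideanreal F" by simp
  \<comment> \<open>The upper bound says that \<omega> is a modulus for \<open>g\<close> on
    \<open>K\<close>; the lower bound takes \<open>k\<close> itself as the competitor in the
    supremum.\<close>
  have "F (p k) = g k" if k: "k \<in> topspace K" for k
  proof (rule antisym)
    show "F (p k) \<le> g k" unfolding F_def
    proof (rule cSUP_least[OF ne])
      fix k' assume k': "k' \<in> topspace K"
      have "g k' - g k \<le> \<omega> (q (p k) (p k'))"
        using gB[OF k k'] q_nonneg pZ k k' by (intro \<omega>_ge) auto
      then show "g k' - \<omega> (q (p k) (p k')) \<le> g k" by simp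
    qed
    show "g k \<le> F (p k)" using upper[OF pZ[OF k] k] q_refl[OF pZ[OF k]] \<omega>0 by simp
  qed
  moreover have "F z' \<le> F z" if "z \<in> topspace Z" "z' \<in> topspace Z" "q z z' = 0" for z z'
    using step[OF that(1,2)] that(3) \<omega>0 by simp
  ultimately show thesis using that contF by blast
qed

section \<open>Topology of histories and plans\<close>

text \<open>Here \<open>c\<close> is a constructor and \<open>d\<close> its destructor. The pullback
  makes \<open>d\<close> continuous, and \<open>c\<close> is continuous because \<open>d\<close>
  after \<open>c\<close> is the identity. Compactness and metrizability thus pass through the
  recursive topologies of histories and plans.\<close>

lemma pullback_homeomorphic_space:
  assumes "\<And>y. y \<in> topspace X \<Longrightarrow> c y \<in> A \<and> d (c y) = y"
    and "\<And>x. x \<in> A \<Longrightarrow> c (d x) = x"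
  shows "pullback_topology A d X homeomorphic_space X"
proof -
  have "continuous_map (pullback_topology A d X) X d"
    using continuous_map_pullback[OF continuous_map_id, of A d X] by (simp add: o_def id_def)
  moreover have "continuous_map X (pullback_topology A d X) c"
  proof (rule continuous_map_pullback')
    show "continuous_map X X (d \<circ> c)"
      by (rule continuous_map_eq[OF continuous_map_id]) (use assms in auto)
  qed (use assms in auto)
  ultimately show ?thesis
    unfolding homeomorphic_space_def homeomorphic_maps_def
    using assms by (intro exI[of _ d] exI[of _ c]) (auto simp: topspace_pullback_topology)
qed

lemma compact_space_Cons_top: "compact_space (Cons_top cbar)"
  unfolding Cons_top_def Cons_set_def by (simp add: compact_space_subtopology)

lemma open_hist_top_homeomorphic:
  "(open_hist_top cbar (Suc t) :: 's history topology) homeomorphic_space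
    prod_topology (open_hist_top cbar t :: 's history topology)
      (prod_topology (Cons_top cbar) (discrete_topology (UNIV :: 's set)))"
  unfolding open_hist_top.simps
  by (rule pullback_homeomorphic_space[where c="\<lambda>(h, c, s). Extend h c s"]) auto

lemma compact_space_open_hist_top: "compact_space (open_hist_top cbar t :: 's::finite history topology)"
proof (induction t)
  case (Suc t)
  then show ?case
    unfolding homeomorphic_compact_space[OF open_hist_top_homeomorphic]
    by (simp del: open_hist_top.simps add: compact_space_prod_topology compact_space_Cons_top
        compact_space_discrete_topology)
qed (simp add: compact_space_discrete_topology)

lemma metrizable_space_open_hist_top: "metrizable_space (open_hist_top cbar t)"
proof (induction t)
  case (Suc t)
  have "metrizable_space (Cons_top cbar)"
    unfolding Cons_top_def by (intro metrizable_space_subtopology metrizable_space_euclidean)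
  with Suc show ?case
    unfolding homeomorphic_metrizable_space[OF open_hist_top_homeomorphic]
    by (simp del: open_hist_top.simps add: metrizable_space_prod_topology)
qed simp

lemma compact_space_plan_top_rem: "compact_space (plan_top_rem cbar k :: 's plan topology)"
proof (induction k)
  case (Suc k)
  have "(plan_top_rem cbar (Suc k) :: 's plan topology) homeomorphic_space
     prod_topology (Cons_top cbar)
       (product_topology (\<lambda>s :: 's. plan_top_rem cbar k :: 's plan topology) UNIV)"
    unfolding plan_top_rem.simps
    by (rule pullback_homeomorphic_space[where c="\<lambda>(c, f). Plan c f"]) auto
  then show ?case
    using Suc
    by (auto simp: homeomorphic_compact_space compact_space_prod_topology compact_space_Cons_top
        compact_space_product_topology)
qed (simp add: compact_space_discrete_topology)

text \<open>Decisions serve as the compact space \<open>K\<close> in both applications of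
  \<open>monotone_extension\<close>. Working with this parametrization avoids a separate proof that
  the graph of attainable continuation values is compact.\<close>

lemma compact_space_dec_top:
  assumes "t \<le> T"
  shows "compact_space (dec_top T cbar t :: ('s::finite history \<times> 's plan) topology)"
  using assms
  by (auto simp: dec_top_def hist_top_def plan_top_def compact_space_prod_topology
      compact_space_open_hist_top compact_space_plan_top_rem)

section \<open>Continuity of plan coordinates, extended histories and value vectors\<close>

lemma continuous_map_plan:
  assumes "t \<le> T"
  shows continuous_map_cur: "continuous_map (plan_top T cbar t) (Cons_top cbar) cur"
    and continuous_map_cont:
      "continuous_map (plan_top T cbar t) (plan_top T cbar (Suc t)) (\<lambda>f. cont f s)"
proof -
  \<comment> \<open>For \<open>t\<close> at most \<open>T\<close> at least one period remains, so
    the recursion defining \<open>plan_top_rem\<close> unfolds once.\<close>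
  have *: "Suc T - t = Suc (Suc T - Suc t)" using assms by simp
  note fst = continuous_map_pullback[OF continuous_map_fst]
    and snd = continuous_map_pullback[OF continuous_map_compose[OF continuous_map_snd
      continuous_map_product_projection[of s UNIV, OF UNIV_I]]]
  show "continuous_map (plan_top T cbar t) (Cons_top cbar) cur"
    unfolding plan_top_def * plan_top_rem.simps
    by (rule continuous_map_eq[OF fst]) auto
  show "continuous_map (plan_top T cbar t) (plan_top T cbar (Suc t)) (\<lambda>f. cont f s)"
    unfolding plan_top_def * plan_top_rem.simps
    by (rule continuous_map_eq[OF snd]) auto
qed

lemma continuous_map_Extend:
  assumes "t < T" "continuous_map X (hist_top T cbar t) h" "continuous_map X (Cons_top cbar) c"
  shows "continuous_map X (hist_top T cbar (Suc t)) (\<lambda>x. Extend (h x) (c x) s)"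
  using assms
  by (auto simp: hist_top_def o_def intro!: continuous_map_pullback' continuous_map_pairedI)

text \<open>With finitely many states the sup-norm topology is the product topology. Each coordinate
  is dominated by \<open>sup_dist\<close>; conversely, a finite intersection of coordinate
  neighbourhoods is open.\<close>

lemma continuous_map_L_top:
  fixes u :: "'x \<Rightarrow> 'a::finite \<Rightarrow> real"
  shows
  "continuous_map X L_top u \<longleftrightarrow> (\<forall>s. continuous_map X euclideanreal (\<lambda>x. u x s))"
proof
  interpret L: Metric_space UNIV "sup_dist :: ('a \<Rightarrow> real) \<Rightarrow> _" by (rule Metric_space_sup_dist)
  show "\<forall>s. continuous_map X euclideanreal (\<lambda>x. u x s)" if u: "continuous_map X L_top u"
  proof
    fix s
    have "continuous_map X Met_TC.mtopology (\<lambda>x. u x s)"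
      unfolding Met_TC.continuous_map_to_metric
    proof (intro ballI allI impI)
      fix x and e :: real assume "x \<in> topspace X" "0 < e"
      then have "\<exists>U. openin X U \<and> x \<in> U \<and> (\<forall>y\<in>U. u y \<in> L.mball (u x) e)"
        using u unfolding L_top_def L.continuous_map_to_metric by simp
      then obtain U where U: "openin X U" "x \<in> U" "\<And>y. y \<in> U \<Longrightarrow> sup_dist (u x) (u y) < e"
        by auto
      have "\<forall>y\<in>U. u y s \<in> Met_TC.mball (u x s) e"
        using le_less_trans[OF sup_dist_ge U(3)] by (auto simp: dist_real_def)
      with U show "\<exists>U. openin X U \<and> x \<in> U \<and> (\<forall>y\<in>U. u y s \<in> Met_TC.mball (u x s) e)" by blast
    qed
    then show "continuous_map X euclideanreal (\<lambda>x. u x s)" by simp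
  qed
  show "continuous_map X L_top u" if u: "\<forall>s. continuous_map X euclideanreal (\<lambda>x. u x s)"
    unfolding L_top_def L.continuous_map_to_metric
  proof (intro ballI allI impI)
    fix x and e :: real assume x: "x \<in> topspace X" and e: "0 < e"
    let ?U = "\<lambda>s. {y \<in> topspace X. u y s \<in> ball (u x s) e}"
    have "openin X (\<Inter>s. ?U s)"
      by (intro openin_INT2 openin_continuous_map_preimage[OF u[rule_format]]) auto
    moreover have "sup_dist (u x) (u y) < e" if "y \<in> (\<Inter>s. ?U s)" for y
      using that by (auto simp: sup_dist_def dist_real_def)
    ultimately show "\<exists>U. openin X U \<and> x \<in> U \<and> (\<forall>y\<in>U. u y \<in> L.mball (u x) e)"
      using x e by (intro exI[of _ "\<Inter>s. ?U s"]) (auto simp: L.in_mball)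
  qed
qed

lemma continuous_map_Max:
  fixes f :: "'i \<Rightarrow> 'a \<Rightarrow> real"
  assumes "finite I" "I \<noteq> {}" "\<And>i. i \<in> I \<Longrightarrow> continuous_map X euclideanreal (f i)"
  shows "continuous_map X euclideanreal (\<lambda>x. MAX i\<in>I. f i x)"
  using assms by (induction I rule: finite_ne_induct) (auto intro!: continuous_map_real_max)

lemma continuous_map_Min:
  fixes f :: "'i \<Rightarrow> 'a \<Rightarrow> real"
  assumes "finite I" "I \<noteq> {}" "\<And>i. i \<in> I \<Longrightarrow> continuous_map X euclideanreal (f i)"
  shows "continuous_map X euclideanreal (\<lambda>x. MIN i\<in>I. f i x)"
  using assms by (induction I rule: finite_ne_induct) (auto intro!: continuous_map_real_min)

lemma continuous_map_cont_util:
  fixes U :: "'s::finite util_sys"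
  assumes t: "t < T" and U: "utility_system T cbar U"
  shows "continuous_map (dec_top T cbar t) L_top (\<lambda>(h, f). cont_util U t h f)"
  unfolding continuous_map_L_top
proof
  fix s
  let ?D = "dec_top T cbar t :: ('s history \<times> 's plan) topology"
  have h: "continuous_map ?D (hist_top T cbar t) fst"
    and f: "continuous_map ?D (plan_top T cbar t) snd"
    unfolding dec_top_def by (rule continuous_map_fst continuous_map_snd)+
  have t': "t \<le> T" using t by simp
  have "continuous_map ?D (dec_top T cbar (Suc t))
      (\<lambda>x. (Extend (fst x) (cur (snd x)) s, cont (snd x) s))"
    unfolding dec_top_def[of T cbar "Suc t"]
    using continuous_map_compose[OF f continuous_map_cur[OF t']]
      continuous_map_compose[OF f continuous_map_cont[OF t']]
    by (intro continuous_map_pairedI continuous_map_Extend t h) (auto simp: o_def)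
  moreover have "continuous_map (dec_top T cbar (Suc t)) euclideanreal (\<lambda>(h, f). util U (Suc t) h f)"
    using U t by (simp add: utility_system_def)
  ultimately have "continuous_map ?D euclideanreal
      ((\<lambda>(h, f). util U (Suc t) h f) \<circ> (\<lambda>x. (Extend (fst x) (cur (snd x)) s, cont (snd x) s)))"
    by (rule continuous_map_compose)
  then show "continuous_map ?D euclideanreal
      (\<lambda>x. (case x of (h, f) \<Rightarrow> cont_util U t h f) s)"
    by (rule continuous_map_eq) (auto simp: cont_util_def)
qed

section \<open>The recursive structure\<close>

text \<open>A metric on histories enters the asymmetric distances below, so that only decisions at
  the same history are comparable.\<close>

lemma ex_metric_hist_top:
  assumes "t \<le> T"
  obtains m where "(hist_top T cbar t :: 's history topology) = mtopology_of m"
proof -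
  have "metrizable_space (hist_top T cbar t :: 's history topology)"
    using assms by (simp add: hist_top_def metrizable_space_open_hist_top)
  then obtain M d where "Metric_space M d"
    "(hist_top T cbar t :: 's history topology) = Metric_space.mtopology M d"
    by (auto simp: metrizable_space_def)
  then show thesis
    using that[of "metric (M, d)"] by (simp add: Metric_space.mtopology_of)
qed

lemma dec_simps:
  assumes "t < T"
  shows "(h, f) \<in> topspace (dec_top T cbar t) \<longleftrightarrow> h \<in> hists T cbar t \<and>
    (\<exists>c f'. f = Plan c f' \<and> c \<in> Cons_set cbar \<and> f' \<in> UNIV \<rightarrow> plans T cbar (Suc t))"
  using plans_step[of t T cbar] assms by (auto simp: dec_top_def hists_def plans_def)

lemma cont_util_in_Lambda:
  assumes "c \<in> Cons_set cbar" "f \<in> UNIV \<rightarrow> plans T cbar (Suc t)"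
  shows "cont_util U t h (Plan c f) \<in> Lambda T cbar U t h"
  using assms unfolding Lambda_def Lambda_at_def by blast

text \<open>Each decision is sent to its history and continuation vector, a point of
  \<open>DM\<close>. This turns \<open>M0\<close> into a continuous function on the compact decision
  space.\<close>

lemma continuous_map_certainty_equivalent:
  fixes U :: "'s::finite util_sys"
  assumes t: "t < T" and U: "utility_system T cbar U"
    and M0: "continuous_map
      (subtopology (prod_topology (hist_top T cbar t) L_top) (DM T cbar U t))
      euclideanreal (\<lambda>(h, u). M0 h u)"
  shows "continuous_map (dec_top T cbar t) euclideanreal (\<lambda>(h, f). M0 h (cont_util U t h f))"
proof -
  let ?D = "dec_top T cbar t :: ('s history \<times> 's plan) topology"
  have "continuous_map ?D (prod_topology (hist_top T cbar t) L_top)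
      (\<lambda>x. (fst x, (\<lambda>(h, f). cont_util U t h f) x))"
    by (intro continuous_map_pairedI continuous_map_cont_util[OF t U])
      (simp add: dec_top_def continuous_map_fst)
  then have "continuous_map ?D
      (subtopology (prod_topology (hist_top T cbar t) L_top) (DM T cbar U t))
      (\<lambda>x. (fst x, (\<lambda>(h, f). cont_util U t h f) x))"
    by (auto simp: continuous_map_in_subtopology DM_def dec_simps[OF t] intro: cont_util_in_Lambda)
  from continuous_map_compose[OF this M0] show ?thesis
    by (rule continuous_map_eq) auto
qed

text \<open>Clamping a monotone extension between the least and the greatest coordinate forces
  the value \<open>v\<close> at constant vectors; by the bounds on \<open>M0\<close> it changes nothing on the domain of \<open>M0\<close>.\<close>

lemma certainty_equivalent_extension:
  fixes U :: "'s::finite util_sys"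
  assumes t: "t < T" and U: "utility_system T cbar U"
    and M0: "continuous_map
      (subtopology (prod_topology (hist_top T cbar t) L_top) (DM T cbar U t))
      euclideanreal (\<lambda>(h, u). M0 h u)"
    and bounds: "\<And>h u. h \<in> hists T cbar t \<Longrightarrow> u \<in> Lambda T cbar U t h \<Longrightarrow>
      (MIN s. u s) \<le> M0 h u \<and> M0 h u \<le> (MAX s. u s)"
    and mono: "\<And>h u v. h \<in> hists T cbar t \<Longrightarrow> u \<in> Lambda T cbar U t h \<Longrightarrow>
      v \<in> Lambda T cbar U t h \<Longrightarrow> u \<le> v \<Longrightarrow> M0 h u \<le> M0 h v"
  obtains M where
    "continuous_map (prod_topology (hist_top T cbar t) L_top) euclideanreal (\<lambda>(h, u). M h u)"
    "\<And>h. h \<in> hists T cbar t \<Longrightarrow> mono (M h)"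
    "\<And>h v. M h (\<lambda>_. v) = v"
    "\<And>h u. h \<in> hists T cbar t \<Longrightarrow> u \<in> Lambda T cbar U t h \<Longrightarrow> M h u = M0 h u"
proof -
  obtain m where m: "(hist_top T cbar t :: 's history topology) = mtopology_of m"
    using ex_metric_hist_top[of t T cbar] t by auto
  have ms: "mspace m = hists T cbar t"
    using m by (metis hists_def topspace_mtopology_of)
  let ?Z = "prod_topology (hist_top T cbar t) L_top :: ('s history \<times> ('s \<Rightarrow> real)) topology"
  let ?ZZ = "prod_topology ?Z ?Z"
  let ?p = "\<lambda>x. (fst x, (\<lambda>(h, f). cont_util U t h f) x)"
  \<comment> \<open>For histories in the space, \<open>q z z'\<close> vanishes exactly when the
    histories agree and the vector of \<open>z'\<close> lies below that of \<open>z\<close>. Summing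
    the positive parts of the differences keeps the triangle inequality.\<close>
  define q where "q z z' = mdist m (fst z) (fst z') + (\<Sum>s\<in>UNIV. max 0 (snd z' s - snd z s))"
    for z z' :: "'s history \<times> ('s \<Rightarrow> real)"
  have coord: "continuous_map X euclideanreal (\<lambda>x. u x s)" if "continuous_map X L_top u"
    for X :: "'x topology" and u :: "'x \<Rightarrow> 's \<Rightarrow> real" and s
    using that continuous_map_L_top by blast
  have Zsnd: "continuous_map ?ZZ L_top (\<lambda>x. snd (fst x))" "continuous_map ?ZZ L_top (\<lambda>x. snd (snd x))"
    using continuous_map_compose[OF continuous_map_fst continuous_map_snd]
      continuous_map_compose[OF continuous_map_snd continuous_map_snd] by (auto simp: o_def)
  have Zfst: "continuous_map ?ZZ (mtopology_of m) (\<lambda>x. fst (fst x))"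
    "continuous_map ?ZZ (mtopology_of m) (\<lambda>x. fst (snd x))"
    using continuous_map_compose[OF continuous_map_fst continuous_map_fst]
      continuous_map_compose[OF continuous_map_snd continuous_map_fst] by (auto simp: o_def m)
  have q_zero: "fst z = fst z' \<and> snd z' \<le> snd z"
    if "q z z' = 0" "fst z \<in> mspace m" "fst z' \<in> mspace m" for z z'
  proof -
    have "0 \<le> (\<Sum>s\<in>UNIV. max 0 (snd z' s - snd z s))" by (simp add: sum_nonneg)
    then have "mdist m (fst z) (fst z') = 0" "(\<Sum>s\<in>UNIV. max 0 (snd z' s - snd z s)) = 0"
      using that(1) mdist_nonneg[of m "fst z" "fst z'"] unfolding q_def by linarith+
    then have eq: "fst z = fst z'" and "max 0 (snd z' s - snd z s) = 0" for s
      using that by (auto simp: sum_nonneg_eq_0_iff)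
    from this(2) have "snd z' s - snd z s \<le> 0" for s by (metis max.cobounded2)
    then show ?thesis using eq by (simp add: le_fun_def)
  qed
  obtain F where F: "continuous_map ?Z euclideanreal F"
    and F_eq: "\<And>k. k \<in> topspace (dec_top T cbar t) \<Longrightarrow> F (?p k) = (\<lambda>(h, f). M0 h (cont_util U t h f)) k"
    and F_mono: "\<And>z z'. z \<in> topspace ?Z \<Longrightarrow> z' \<in> topspace ?Z \<Longrightarrow> q z z' = 0 \<Longrightarrow> F z' \<le> F z"
  proof (rule monotone_extension[where q=q and p="?p" and K="dec_top T cbar t" and Z="?Z"
        and g="\<lambda>(h, f). M0 h (cont_util U t h f)"])
    show "compact_space (dec_top T cbar t :: ('s history \<times> 's plan) topology)"
      using t by (intro compact_space_dec_top) simp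
    show "continuous_map (dec_top T cbar t) ?Z ?p"
      by (intro continuous_map_pairedI continuous_map_cont_util[OF t U])
        (simp add: dec_top_def continuous_map_fst)
    show "continuous_map (dec_top T cbar t) euclideanreal (\<lambda>(h, f). M0 h (cont_util U t h f))"
      by (rule continuous_map_certainty_equivalent[OF t U M0])
    show "continuous_map ?ZZ euclideanreal (\<lambda>(x, y). q x y)"
      unfolding q_def case_prod_beta
      by (intro continuous_map_add continuous_map_sum continuous_map_real_max continuous_map_diff
          coord[OF Zsnd(1)] coord[OF Zsnd(2)] continuous_map_mdist Zfst) auto
    show "0 \<le> q x y" for x y
      by (simp add: q_def sum_nonneg)
    show "q x x = 0" if "x \<in> topspace ?Z" for x
      using that by (auto simp: q_def m)
    show "q x z \<le> q x y + q y z" if "x \<in> topspace ?Z" "y \<in> topspace ?Z" "z \<in> topspace ?Z" for x y z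
    proof -
      have "(\<Sum>s\<in>UNIV. max 0 (snd z s - snd x s)) \<le>
          (\<Sum>s\<in>UNIV. max 0 (snd y s - snd x s) + max 0 (snd z s - snd y s))"
        by (intro sum_mono) auto
      moreover have "mdist m (fst x) (fst z) \<le> mdist m (fst x) (fst y) + mdist m (fst y) (fst z)"
        using that by (intro mdist_triangle) (auto simp: m)
      ultimately show ?thesis by (simp add: q_def sum.distrib)
    qed
    show "(\<lambda>(h, f). M0 h (cont_util U t h f)) k' \<le> (\<lambda>(h, f). M0 h (cont_util U t h f)) k"
      if "k \<in> topspace (dec_top T cbar t)" "k' \<in> topspace (dec_top T cbar t)" "q (?p k) (?p k') = 0"
      for k k' :: "'s history \<times> 's plan"
    proof -
      obtain h f h' f' where k: "k = (h, f)" "k' = (h', f')" by fastforce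
      have h: "h \<in> hists T cbar t" "h' \<in> hists T cbar t"
        and L: "cont_util U t h f \<in> Lambda T cbar U t h" "cont_util U t h' f' \<in> Lambda T cbar U t h'"
        using that(1,2) by (auto simp: k dec_simps[OF t] intro: cont_util_in_Lambda)
      have "h = h'" "cont_util U t h' f' \<le> cont_util U t h f"
        using q_zero[OF that(3)] h by (auto simp: k ms)
      then show ?thesis using mono h L by (auto simp: k)
    qed
  qed blast
  define M where "M h u = max (MIN s. u s) (min (MAX s. u s) (F (h, u)))" for h and u :: "'s \<Rightarrow> real"
  \<comment> \<open>Every vector in \<open>Lambda\<close> comes from some plan, so the values
    prescribed on decisions determine \<open>F\<close> on all of \<open>DM\<close>.\<close>
  have FM: "F (h, u) = M0 h u" if h: "h \<in> hists T cbar t" and u: "u \<in> Lambda T cbar U t h" for h u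
  proof -
    obtain c f where "u = cont_util U t h (Plan c f)" "c \<in> Cons_set cbar" "f \<in> UNIV \<rightarrow> plans T cbar (Suc t)"
      using u by (auto simp: Lambda_def Lambda_at_def)
    then show ?thesis using F_eq[of "(h, Plan c f)"] h by (simp add: dec_simps[OF t])
  qed
  show thesis
  proof (rule that[of M])
    have "continuous_map ?Z euclideanreal (\<lambda>x. max (MIN s. snd x s) (min (MAX s. snd x s) (F x)))"
      by (intro continuous_map_real_max continuous_map_real_min continuous_map_Max
          continuous_map_Min coord[OF continuous_map_snd] F) auto
    then show "continuous_map ?Z euclideanreal (\<lambda>(h, u). M h u)"
      by (rule continuous_map_eq) (auto simp: M_def)
    show "mono (M h)" if "h \<in> hists T cbar t" for h
    proof (rule monoI)
      fix u v :: "'s \<Rightarrow> real" assume uv: "u \<le> v"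
      have "(MIN s. u s) \<le> v s" for s
        by (rule order_trans[OF Min_le le_funD[OF uv]]) auto
      then have "(MIN s. u s) \<le> (MIN s. v s)" by simp
      moreover have "u s \<le> (MAX s. v s)" for s
        by (rule order_trans[OF le_funD[OF uv] Max_ge]) auto
      then have "(MAX s. u s) \<le> (MAX s. v s)" by simp
      \<comment> \<open>The distance from \<open>(h, v)\<close> to \<open>(h, u)\<close> is zero, as
        every positive part of \<open>u s - v s\<close> vanishes.\<close>
      moreover have "F (h, u) \<le> F (h, v)"
        using uv that
        by (intro F_mono) (auto simp: topspace_L_top hists_def[symmetric] q_def ms le_fun_def)
      ultimately show "M h u \<le> M h v" unfolding M_def by (intro max.mono min.mono)
    qed
    show "M h (\<lambda>_. v) = v" for h v by (simp add: M_def)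
    show "M h u = M0 h u" if "h \<in> hists T cbar t" "u \<in> Lambda T cbar U t h" for h u
      using bounds[OF that] FM[OF that] by (simp add: M_def)
  qed
qed

section \<open>Extension of the aggregator\<close>

text \<open>Applied in both directions, \<open>mono\<close> shows that equal values of
  \<open>v\<close> at the same history and consumption force equal utilities. The utility is
  therefore a function of history, consumption and \<open>v\<close>, nondecreasing in the last, and
  \<open>monotone_extension\<close> applies.\<close>

lemma aggregator_extension:
  fixes U :: "'s::finite util_sys"
  assumes t: "t < T" and U: "utility_system T cbar U"
    and v: "continuous_map (dec_top T cbar t) euclideanreal (\<lambda>(h, f). v h f)"
    and mono: "\<And>h c f g. h \<in> hists T cbar t \<Longrightarrow> c \<in> Cons_set cbar \<Longrightarrow>
      f \<in> UNIV \<rightarrow> plans T cbar (Suc t) \<Longrightarrow> g \<in> UNIV \<rightarrow> plans T cbar (Suc t) \<Longrightarrow>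
      v h (Plan c g) \<le> v h (Plan c f) \<Longrightarrow> util U t h (Plan c g) \<le> util U t h (Plan c f)"
  obtains W where
    "continuous_map
      (prod_topology (hist_top T cbar t) (prod_topology (Cons_top cbar) euclideanreal))
      euclideanreal (\<lambda>(h, c, v). W h c v)"
    "\<And>h c. h \<in> hists T cbar t \<Longrightarrow> c \<in> Cons_set cbar \<Longrightarrow> mono (W h c)"
    "\<And>h c f. h \<in> hists T cbar t \<Longrightarrow> c \<in> Cons_set cbar \<Longrightarrow>
      f \<in> UNIV \<rightarrow> plans T cbar (Suc t) \<Longrightarrow> W h c (v h (Plan c f)) = util U t h (Plan c f)"
proof -
  obtain m where m: "(hist_top T cbar t :: 's history topology) = mtopology_of m"
    using ex_metric_hist_top[of t T cbar] t by auto
  have ms: "mspace m = hists T cbar t"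
    using m by (metis hists_def topspace_mtopology_of)
  let ?D = "dec_top T cbar t :: ('s history \<times> 's plan) topology"
  let ?Z = "prod_topology (hist_top T cbar t) (prod_topology (Cons_top cbar) euclideanreal)
    :: ('s history \<times> real \<times> real) topology"
  let ?ZZ = "prod_topology ?Z ?Z"
  let ?p = "\<lambda>x. (fst x, cur (snd x), (\<lambda>(h, f). v h f) x)"
  \<comment> \<open>Only points with equal history and equal consumption are ordered, so
    monotonicity is imposed in the last argument alone.\<close>
  define q where "q z z' = mdist m (fst z) (fst z') + \<bar>fst (snd z) - fst (snd z')\<bar>
      + max 0 (snd (snd z') - snd (snd z))"
    for z z' :: "'s history \<times> real \<times> real"
  have 1: "continuous_map ?Z (mtopology_of m) fst"
    by (simp add: m[symmetric] continuous_map_fst)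
  have 2: "continuous_map ?Z euclideanreal (\<lambda>x. fst (snd x))"
    using continuous_map_compose[OF continuous_map_snd continuous_map_fst,
        of "hist_top T cbar t :: 's history topology" "Cons_top cbar" euclideanreal]
    by (simp add: o_def Cons_top_def continuous_map_in_subtopology)
  have 3: "continuous_map ?Z euclideanreal (\<lambda>x. snd (snd x))"
    using continuous_map_compose[OF continuous_map_snd continuous_map_snd] by (auto simp: o_def)
  note c1 = continuous_map_compose[OF continuous_map_fst, unfolded o_def]
    and c2 = continuous_map_compose[OF continuous_map_snd, unfolded o_def]
  have q_zero: "fst z = fst z' \<and> fst (snd z) = fst (snd z') \<and> snd (snd z') \<le> snd (snd z)"
    if "q z z' = 0" "fst z \<in> mspace m" "fst z' \<in> mspace m" for z z'
  proof -
    have "mdist m (fst z) (fst z') = 0" "fst (snd z) = fst (snd z')" "snd (snd z') \<le> snd (snd z)"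
      using that(1) mdist_nonneg[of m "fst z" "fst z'"] unfolding q_def by linarith+
    then show ?thesis using that by auto
  qed
  obtain F where F: "continuous_map ?Z euclideanreal F"
    and F_eq: "\<And>k. k \<in> topspace ?D \<Longrightarrow> F (?p k) = (\<lambda>(h, f). util U t h f) k"
    and F_mono: "\<And>z z'. z \<in> topspace ?Z \<Longrightarrow> z' \<in> topspace ?Z \<Longrightarrow> q z z' = 0 \<Longrightarrow> F z' \<le> F z"
  proof (rule monotone_extension[where q=q and p="?p" and K="?D" and Z="?Z"
        and g="\<lambda>(h, f). util U t h f"])
    show "compact_space ?D"
      using t by (intro compact_space_dec_top) simp
    have "continuous_map ?D (Cons_top cbar) (\<lambda>x. cur (snd x))"
      unfolding dec_top_def using t by (intro c2 continuous_map_cur) simp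
    then show "continuous_map ?D ?Z ?p"
      by (intro continuous_map_pairedI v) (simp_all add: dec_top_def continuous_map_fst)
    show "continuous_map ?D euclideanreal (\<lambda>(h, f). util U t h f)"
      using U t by (simp add: utility_system_def)
    show "continuous_map ?ZZ euclideanreal (\<lambda>(x, y). q x y)"
      unfolding q_def case_prod_beta
      by (intro continuous_map_add continuous_map_real_abs continuous_map_real_max
          continuous_map_diff continuous_map_mdist c1[OF 1] c2[OF 1] c1[OF 2] c2[OF 2] c1[OF 3]
          c2[OF 3]) auto
    show "0 \<le> q x y" for x y
      by (simp add: q_def)
    show "q x x = 0" if "x \<in> topspace ?Z" for x
      using that by (auto simp: q_def m)
    show "q x z \<le> q x y + q y z" if "x \<in> topspace ?Z" "y \<in> topspace ?Z" "z \<in> topspace ?Z" for x y z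
    proof -
      have "mdist m (fst x) (fst z) \<le> mdist m (fst x) (fst y) + mdist m (fst y) (fst z)"
        using that by (intro mdist_triangle) (auto simp: m)
      then show ?thesis unfolding q_def by linarith
    qed
    show "(\<lambda>(h, f). util U t h f) k' \<le> (\<lambda>(h, f). util U t h f) k"
      if k: "k \<in> topspace ?D" "k' \<in> topspace ?D" and "q (?p k) (?p k') = 0"
      for k k'
    proof -
      obtain h c f where 1: "k = (h, Plan c f)" "h \<in> hists T cbar t" "c \<in> Cons_set cbar"
          "f \<in> UNIV \<rightarrow> plans T cbar (Suc t)"
        using k(1) dec_simps[OF t] by (metis surj_pair)
      obtain h' c' f' where 2: "k' = (h', Plan c' f')" "h' \<in> hists T cbar t"
          "f' \<in> UNIV \<rightarrow> plans T cbar (Suc t)"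
        using k(2) dec_simps[OF t] by (metis surj_pair)
      show ?thesis
        using q_zero[OF that(3)] mono[OF 1(2,3,4) 2(3)] 1 2 by (auto simp: ms)
    qed
  qed blast
  show thesis
  proof (rule that[of "\<lambda>h c v. F (h, c, v)"])
    show "continuous_map ?Z euclideanreal (\<lambda>(h, c, v). F (h, c, v))" using F by simp
    show "mono (\<lambda>v. F (h, c, v))" if "h \<in> hists T cbar t" "c \<in> Cons_set cbar" for h c
      using that by (intro monoI F_mono) (auto simp: q_def ms hists_def Cons_top_def)
    show "F (h, c, v h (Plan c f)) = util U t h (Plan c f)"
      if "h \<in> hists T cbar t" "c \<in> Cons_set cbar" "f \<in> UNIV \<rightarrow> plans T cbar (Suc t)" for h c f
      using F_eq[of "(h, Plan c f)"] that by (simp add: dec_simps[OF t])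
  qed
qed

section \<open>The recursion at a single date\<close>

text \<open>The recursion equation uses the continuation utilities of the given \<open>U\<close>,
  not generated ones. The dates thereby decouple, and a pair \<open>W\<close>, \<open>M\<close> can
  be chosen for each separately.\<close>

definition recursion_step ::
    "nat \<Rightarrow> real \<Rightarrow> 's::finite util_sys \<Rightarrow> nat \<Rightarrow> ('s history \<Rightarrow> real \<Rightarrow> real \<Rightarrow> real) \<Rightarrow>
     ('s history \<Rightarrow> ('s \<Rightarrow> real) \<Rightarrow> real) \<Rightarrow> bool" where
  "recursion_step T cbar U t W M \<longleftrightarrow>
    continuous_map
      (prod_topology (hist_top T cbar t) (prod_topology (Cons_top cbar) euclideanreal))
      euclideanreal (\<lambda>(h, c, v). W h c v) \<and>
    (\<forall>h\<in>hists T cbar t. \<forall>c\<in>Cons_set cbar. mono (W h c)) \<and>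
    continuous_map (prod_topology (hist_top T cbar t) L_top) euclideanreal (\<lambda>(h, u). M h u) \<and>
    (\<forall>h\<in>hists T cbar t. mono (M h) \<and> (\<forall>v. M h (\<lambda>_. v) = v)) \<and>
    (\<forall>h\<in>hists T cbar t. \<forall>c\<in>Cons_set cbar. \<forall>f \<in> UNIV \<rightarrow> plans T cbar (Suc t).
      W h c (M h (cont_util U t h (Plan c f))) = util U t h (Plan c f))"

lemma ex_recursion_step:
  fixes U :: "'s::finite util_sys"
  assumes t: "t < T" and U: "utility_system T cbar U" and comp: "compatible T cbar U P"
    and rich: "ce_richness T cbar U P"
  shows "\<exists>W M. recursion_step T cbar U t W M"
proof -
  obtain M0 where M0: "continuous_map
      (subtopology (prod_topology (hist_top T cbar t) L_top) (DM T cbar U t))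
      euclideanreal (\<lambda>(h, u). M0 h u)"
    and rep: "\<And>h c f g. h \<in> hists T cbar t \<Longrightarrow> c \<in> Cons_set cbar \<Longrightarrow>
      f \<in> UNIV \<rightarrow> plans T cbar (Suc t) \<Longrightarrow> g \<in> UNIV \<rightarrow> plans T cbar (Suc t) \<Longrightarrow>
      (Plan c f, Plan c g) \<in> cond_pref P t h \<longleftrightarrow>
      M0 h (cont_util U t h (Plan c g)) \<le> M0 h (cont_util U t h (Plan c f))"
    and bounds: "\<And>h u. h \<in> hists T cbar t \<Longrightarrow> u \<in> Lambda T cbar U t h \<Longrightarrow>
      (MIN s. u s) \<le> M0 h u \<and> M0 h u \<le> (MAX s. u s)"
    and mono: "\<And>h u v. h \<in> hists T cbar t \<Longrightarrow> u \<in> Lambda T cbar U t h \<Longrightarrow>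
      v \<in> Lambda T cbar U t h \<Longrightarrow> u \<le> v \<Longrightarrow> M0 h u \<le> M0 h v"
    using rich[unfolded ce_richness_def, rule_format, OF t]
  proof (elim exE conjE, goal_cases)
    case (1 M0)
    show ?case by (rule 1(1)[OF 1(2)]) (use 1(3) in simp_all)
  qed
  obtain M where M:
    "continuous_map (prod_topology (hist_top T cbar t) L_top) euclideanreal (\<lambda>(h, u). M h u)"
    "\<And>h. h \<in> hists T cbar t \<Longrightarrow> mono (M h)"
    "\<And>h v. M h (\<lambda>_. v) = v"
    "\<And>h u. h \<in> hists T cbar t \<Longrightarrow> u \<in> Lambda T cbar U t h \<Longrightarrow> M h u = M0 h u"
    using certainty_equivalent_extension[OF t U M0 bounds mono] by blast
  \<comment> \<open>At a fixed history and consumption, richness makes \<open>M0\<close> rank plans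
    as the conditional preference does, and compatibility makes the utility do the same.\<close>
  have "util U t h (Plan c g) \<le> util U t h (Plan c f)"
    if "h \<in> hists T cbar t" "c \<in> Cons_set cbar" "f \<in> UNIV \<rightarrow> plans T cbar (Suc t)"
      "g \<in> UNIV \<rightarrow> plans T cbar (Suc t)"
      "M0 h (cont_util U t h (Plan c g)) \<le> M0 h (cont_util U t h (Plan c f))" for h c f g
  proof -
    have "Plan c f \<in> plans T cbar t" "Plan c g \<in> plans T cbar t"
      using that t by (auto simp: plans_step)
    moreover have "((h, Plan c f), (h, Plan c g)) \<in> pref P t"
      using rep[OF that(1-4)] that(5) by (simp add: cond_pref_def)
    ultimately show ?thesis
      using comp that(1) less_imp_le[OF t] unfolding compatible_def by blast
  qed
  from aggregator_extension[OF t U continuous_map_certainty_equivalent[OF t U M0] this]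
  obtain W where W: "continuous_map
      (prod_topology (hist_top T cbar t) (prod_topology (Cons_top cbar) euclideanreal))
      euclideanreal (\<lambda>(h, c, v). W h c v)"
    "\<And>h c. h \<in> hists T cbar t \<Longrightarrow> c \<in> Cons_set cbar \<Longrightarrow> mono (W h c)"
    "\<And>h c f. h \<in> hists T cbar t \<Longrightarrow> c \<in> Cons_set cbar \<Longrightarrow> f \<in> UNIV \<rightarrow> plans T cbar (Suc t) \<Longrightarrow>
      W h c (M0 h (cont_util U t h (Plan c f))) = util U t h (Plan c f)"
    by blast
  \<comment> \<open>The aggregator was built from \<open>M0\<close>. Continuation vectors lie in
    \<open>Lambda\<close>, where \<open>M\<close> equals \<open>M0\<close>, so the equation holds
    with \<open>M\<close> as well.\<close>
  have "recursion_step T cbar U t W M"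
    using M W cont_util_in_Lambda[of _ cbar _ T t U] by (simp add: recursion_step_def)
  then show ?thesis by blast
qed

section \<open>Backward induction and representation\<close>

text \<open>Induction runs down from \<open>T\<close>: once both systems agree at
  \<open>Suc t\<close>, their continuation vectors at \<open>t\<close> coincide, and the one-date
  equation for \<open>U\<close> becomes the one that generates utility.\<close>

lemma generated_eq:
  fixes U :: "'s util_sys"
  assumes comp: "compatible T cbar U P"
    and fin: "\<And>h. struct_term V h = final_util U h"
    and step: "\<And>t h c f. t < T \<Longrightarrow> h \<in> hists T cbar t \<Longrightarrow> c \<in> Cons_set cbar \<Longrightarrow>
      f \<in> UNIV \<rightarrow> plans T cbar (Suc t) \<Longrightarrow>
      agg V t h c (ceq V t h (cont_util U t h (Plan c f))) = util U t h (Plan c f)"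
  shows "util_sys_eq T cbar (generated T V) U"
proof -
  have "\<forall>h\<in>hists T cbar t. \<forall>f\<in>plans T cbar t. util (generated T V) t h f = util U t h f"
    if "t \<le> T" for t
    using that
  proof (induction t rule: inc_induct)
    case base
    \<comment> \<open>At date \<open>T\<close> every plan is a \<open>last_plan\<close>, for which
      compatibility gives the utility as the final utility of the closed history.\<close>
    show ?case
      using comp fin
      by (auto simp: plans_last util_generated_last final_util_generated compatible_def)
  next
    case (step t)
    show ?case
    proof (intro ballI)
      fix h :: "'s history" and f :: "'s plan" assume h: "h \<in> hists T cbar t" and "f \<in> plans T cbar t"
      then obtain c f' where f: "f = Plan c f'" "c \<in> Cons_set cbar" "f' \<in> UNIV \<rightarrow> plans T cbar (Suc t)"
        using step.hyps by (auto simp: plans_step)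
      have "Extend h c s \<in> hists T cbar (Suc t)" for s
        using h f step.hyps by (auto simp: hists_Suc)
      then have "cont_util (generated T V) t h f = cont_util U t h f"
        using step.IH f by (simp add: cont_util_def Pi_iff)
      then show "util (generated T V) t h f = util U t h f"
        using assms(3)[OF step.hyps(2) h f(2,3)] step.hyps by (simp add: f util_generated_step)
    qed
  qed
  then show ?thesis by (simp add: util_sys_eq_def final_util_generated fin)
qed

text \<open>Agreement on admissible histories and plans is enough, since continuity and
  compatibility look only at points of these spaces.\<close>

lemma represents_if_util_sys_eq:
  assumes eq: "util_sys_eq T cbar (generated T V) U" and U: "utility_system T cbar U"
    and comp: "compatible T cbar U P"
  shows "represents T cbar V P"
  unfolding represents_def
proof
  have e: "util (generated T V) t h f = util U t h f"
    if "t \<le> T" "h \<in> hists T cbar t" "f \<in> plans T cbar t" for t h f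
    using eq that by (simp add: util_sys_eq_def)
  have e': "final_util (generated T V) h = final_util U h" if "h \<in> hists T cbar (Suc T)" for h
    using eq that by (simp add: util_sys_eq_def)
  show "utility_system T cbar (generated T V)"
    unfolding utility_system_def
  proof (intro conjI allI impI)
    show "continuous_map (dec_top T cbar t) euclideanreal (\<lambda>(h, f). util (generated T V) t h f)"
      if "t \<le> T" for t
      by (rule continuous_map_eq[where f="\<lambda>(h, f). util U t h f"])
        (use U that e in \<open>auto simp: utility_system_def dec_top_def hists_def plans_def\<close>)
    show "continuous_map (hist_top T cbar (Suc T)) euclideanreal (final_util (generated T V))"
      by (rule continuous_map_eq[where f="final_util U"])
        (use U e' in \<open>auto simp: utility_system_def hists_def\<close>)
  qed
  show "compatible T cbar (generated T V) P"
    using comp e e' unfolding compatible_def by (simp add: util_generated_last)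
qed

theorem theorem3p7:
  fixes T :: nat and cbar :: real
    and P :: "'s::finite grand_pref" and U :: "'s util_sys"
  assumes "1 \<le> T" and "0 \<le> cbar"
    and "grand_preference T cbar P"
    and "utility_system T cbar U"
    and "compatible T cbar U P"
    and "weak_order T cbar P"
    and "continuity T cbar P"
    and "dynamic_consistency T cbar P"
    and "terminal_compatibility T cbar P"
    and "compensated_monotonicity T cbar P"
    and "weak_separability T cbar P"
    and "ce_richness T cbar U P"
  shows "\<exists>V :: 's rec_struct.
           recursive_structure T cbar V \<and>
           util_sys_eq T cbar (generated T V) U \<and>
           represents T cbar V P"
proof -
  note U = assms(4) and comp = assms(5) and rich = assms(12)
  obtain W M where WM: "\<And>t. t < T \<Longrightarrow> recursion_step T cbar U t (W t) (M t)"
    using ex_recursion_step[OF _ U comp rich] by metis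
  \<comment> \<open>The terminal component is copied from \<open>U\<close>, which anchors the
    backward induction.\<close>
  define V where "V = \<lparr>agg = W, ceq = M, struct_term = final_util U\<rparr>"
  have "recursive_structure T cbar V"
    using U WM by (simp add: recursive_structure_def V_def utility_system_def recursion_step_def)
  moreover have "util_sys_eq T cbar (generated T V) U"
    using WM by (intro generated_eq[OF comp]) (auto simp: V_def recursion_step_def)
  ultimately show ?thesis
    using represents_if_util_sys_eq[OF _ U comp] by blast
qed

end
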